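(* Let $t>0$, let $\mathcal{B}_t$ be the Brownian diffusion kernel on $SE(3)$, and let $P(\cdot\mid O_1,O_2)$ be a diffusion origin selection mechanism, i.e. a probability distribution on $\mathbb{R}^3$ conditioned on a pair of point clouds $O_1,O_2\in\mathcal{O}$. Consider the diffusion kernel $$P_{t|0}(g\mid g_0,O_s,O_e)=\int_{SE(3)}dg_{ed}\;P(g_{ed}\mid g_0^{-1}\cdot O_s,O_e)\;\mathcal{B}_t\!\left(g_{ed}^{-1}g_0^{-1}g\,g_{ed}\right)$$ with the frame selection mechanism, for $g_{ed}=(p_{ed},R_{ed})$, $$P(g_{ed}\mid g_0^{-1}\cdot O_s,O_e)=P(p_{ed}\mid g_0^{-1}\cdot O_s,O_e)\,\delta(R_{ed}),$$ where $\delta$ is the Dirac delta on $SO(3)$ at the identity. If the origin selection mechanism is equivariant in the sense that $$P(p_{ed}\mid g_0^{-1}\cdot O_s,O_e)=P(\Delta g\,p_{ed}\mid(\Delta g\,g_0^{-1})\cdot O_s,\Delta g\cdot O_e)$$ for all $\Delta g,g_0\in SE(3)$, $p_{ed}\in\mathbb{R}^3$ and $O_s,O_e\in\mathcal{O}$, then the diffusion kernel $P_{t|0}$ is bi-equivariant.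
   Context: $\mathcal{O}$ is the set of point clouds in $\mathbb{R}^3$, on which $SE(3)$ acts from the left by rigid motion of the points, written $\Delta g\cdot O$. Elements of $SE(3)$ are written $g=(p,R)$ with $p\in\mathbb{R}^3$, $R\in SO(3)$, acting on $x\in\mathbb{R}^3$ by $g\,x=Rx+p$. $dg=dR\,dp$ is the bi-invariant (Haar) measure on $SE(3)$, with $dR$ the normalized Haar measure on $SO(3)$. Origin selection mechanisms are probability distributions on $\mathbb{R}^3$ (possibly singular, e.g. sums of point masses, in which case the equivariance identity is one of measures). Because of the Dirac factor, the integral over $g_{ed}$ is the integral over $g_{ed}=(p_{ed},I)$ with $p_{ed}$ distributed according to $P(\cdot\mid g_0^{-1}\cdot O_s,O_e)$. The Brownian diffusion kernel is, for $g=(p,R)$, $$\mathcal{B}_t(g)=\mathcal{N}(p;\mu=0,\Sigma=tI)\;\mathcal{IG}_{SO(3)}(R;\epsilon=t/2),\qquad \mathcal{IG}_{SO(3)}(R;\epsilon)=\sum_{l=0}^{\infty}(2l+1)e^{-\epsilon l(l+1)}\frac{\sin\left(l\theta+\frac{\theta}{2}\right)}{\sin(\theta/2)},$$ where $\mathcal{N}$ is the normal density on $\mathbb{R}^3$ and $\theta\in[0,\pi]$ is the rotation angle of $R$ (with the value at $\theta=0$ by continuity). A bi-equivariant diffusion kernel is a square-integrable (in $g$) kernel $P_{t|0}$ satisfying, for all $\Delta g\in SE(3)$ (and all $O_s,O_e\in\mathcal{O}$), except on a set of measure zero, $$P_{t|0}(g\mid g_0,O_s,O_e)=P_{t|0}(\Delta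 g\,g\mid\Delta g\,g_0,\Delta g\cdot O_s,O_e)=P_{t|0}(g\,\Delta g^{-1}\mid g_0\,\Delta g^{-1},O_s,\Delta g\cdot O_e).$$ *)

theory Defs
  imports "HOL-Probability.Probability"
begin

unbundle no cross3_syntax

section \<open>Rotations, rigid motions and point clouds\<close>

definition SO3 :: "(real^3^3) set" where
  "SO3 = {R. rotation_matrix R}"

text \<open>A pair \<open>(p, R)\<close> stands for the rigid motion \<open>x \<mapsto> R x + p\<close>.\<close>

type_synonym rigid = "(real^3) \<times> (real^3^3)"

definition SE3 :: "rigid set" where
  "SE3 = UNIV \<times> SO3"

definition se3_act :: "rigid \<Rightarrow> real^3 \<Rightarrow> real^3" where
  "se3_act g x = snd g *v x + fst g"

definition se3_one :: rigid where
  "se3_one = (0, mat 1)"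

definition se3_mult :: "rigid \<Rightarrow> rigid \<Rightarrow> rigid" where
  "se3_mult g h = (snd g *v fst h + fst g, snd g ** snd h)"

definition se3_inv :: "rigid \<Rightarrow> rigid" where
  "se3_inv g = (- (transpose (snd g) *v fst g), transpose (snd g))"

text \<open>The empty cloud is excluded: it is fixed by all rigid motions, and no probability
  distribution on \<open>\<real>\<^sup>3\<close> is translation invariant, so that no equivariant origin selection
  mechanism could be defined on a pair of empty clouds.\<close>

definition point_clouds :: "(real^3) set set" where
  "point_clouds = {C. finite C \<and> C \<noteq> {}}"

definition cloud_act :: "rigid \<Rightarrow> (real^3) set \<Rightarrow> (real^3) set" where
  "cloud_act g C = se3_act g ` C"

lemma SO3_orthogonal: "R \<in> SO3 \<Longrightarrow> orthogonal_matrix R"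
  and SO3_det: "R \<in> SO3 \<Longrightarrow> det R = 1"
  by (auto simp: SO3_def rotation_matrix_def)

lemma SO3_one: "mat 1 \<in> SO3"
  by (simp add: SO3_def rotation_matrix_def orthogonal_matrix_id)

lemma SO3_mult: "Q \<in> SO3 \<Longrightarrow> R \<in> SO3 \<Longrightarrow> Q ** R \<in> SO3"
  by (simp add: SO3_def rotation_matrix_def orthogonal_matrix_mul det_mul)

lemma SO3_transpose: "R \<in> SO3 \<Longrightarrow> transpose R \<in> SO3"
  by (simp add: SO3_def rotation_matrix_def det_transpose)

lemma SO3_transpose_mult:
  assumes "R \<in> SO3"
  shows "transpose R ** R = mat 1" "R ** transpose R = mat 1"
  using SO3_orthogonal[OF assms] by (auto simp: orthogonal_matrix_def)

lemma se3_act_one: "se3_act se3_one x = x"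
  by (simp add: se3_act_def se3_one_def)

lemma se3_act_mult: "se3_act (se3_mult g h) x = se3_act g (se3_act h x)"
  by (simp add: se3_act_def se3_mult_def matrix_vector_mul_assoc matrix_vector_right_distrib)

lemma se3_inv_mult:
  assumes "g \<in> SE3"
  shows "se3_mult (se3_inv g) g = se3_one" "se3_mult g (se3_inv g) = se3_one"
proof -
  have R: "snd g \<in> SO3"
    using assms by (auto simp: SE3_def)
  show "se3_mult (se3_inv g) g = se3_one"
    using SO3_transpose_mult(1)[OF R] by (simp add: se3_mult_def se3_inv_def se3_one_def)
  show "se3_mult g (se3_inv g) = se3_one"
    using SO3_transpose_mult(2)[OF R] linear_neg[OF matrix_vector_mul_linear[of "snd g"]]
    by (simp add: se3_mult_def se3_inv_def se3_one_def matrix_vector_mul_assoc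
        del: transpose_matrix_vector)
qed

section \<open>Haar measures\<close>

definition SO3_borel :: "(real^3^3) measure" where
  "SO3_borel = restrict_space borel SO3"

definition normalized_haar_SO3 :: "(real^3^3) measure \<Rightarrow> bool" where
  "normalized_haar_SO3 M \<longleftrightarrow>
     sets M = sets SO3_borel \<and> prob_space M \<and>
     (\<forall>Q\<in>SO3. distr M M (\<lambda>R. Q ** R) = M) \<and>
     (\<forall>Q\<in>SO3. distr M M (\<lambda>R. R ** Q) = M)"

text \<open>Existence and uniqueness are shown in \<open>normalized_haar_SO3_haar\<close> and
  \<open>normalized_haar_SO3_unique\<close> below.\<close>

definition SO3_haar :: "(real^3^3) measure" where
  "SO3_haar = (THE M. normalized_haar_SO3 M)"

definition SE3_haar :: "rigid measure" where
  "SE3_haar = lborel \<Otimes>\<^sub>M SO3_haar"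

section \<open>The Brownian diffusion kernel\<close>

definition mvnormal_density :: "real^'n \<Rightarrow> real^'n^'n \<Rightarrow> real^'n \<Rightarrow> real" where
  "mvnormal_density \<mu> \<Sigma> p =
     exp (- ((p - \<mu>) \<bullet> (matrix_inv \<Sigma> *v (p - \<mu>))) / 2) / sqrt ((2 * pi) ^ CARD('n) * det \<Sigma>)"

text \<open>The angle \<open>\<theta> \<in> [0, \<pi>]\<close> of a rotation \<open>R\<close> is determined by \<open>tr R = 1 + 2 cos \<theta>\<close>.\<close>

definition rotation_angle :: "real^3^3 \<Rightarrow> real" where
  "rotation_angle R = arccos ((trace R - 1) / 2)"

text \<open>At \<open>\<theta> = 0\<close> the quotient of sines is replaced by its limit.\<close>

definition sine_quotient :: "nat \<Rightarrow> real \<Rightarrow> real" where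
  "sine_quotient l \<theta> =
     (if \<theta> = 0 then 2 * real l + 1 else sin (real l * \<theta> + \<theta> / 2) / sin (\<theta> / 2))"

definition IG_SO3 :: "real \<Rightarrow> real^3^3 \<Rightarrow> real" where
  "IG_SO3 \<epsilon> R =
     (\<Sum>l. (2 * real l + 1) * exp (- \<epsilon> * real l * (real l + 1)) * sine_quotient l (rotation_angle R))"

definition brownian_kernel :: "real \<Rightarrow> rigid \<Rightarrow> real" where
  "brownian_kernel t g = mvnormal_density 0 (t *\<^sub>R mat 1) (fst g) * IG_SO3 (t / 2) (snd g)"

section \<open>Selection mechanisms and diffusion kernels\<close>

definition origin_selection ::
    "((real^3) set \<Rightarrow> (real^3) set \<Rightarrow> (real^3) measure) \<Rightarrow> bool" where
  "origin_selection P \<longleftrightarrow>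
     (\<forall>O1\<in>point_clouds. \<forall>O2\<in>point_clouds. prob_space (P O1 O2) \<and> sets (P O1 O2) = sets borel)"

text \<open>The density identity \<open>P(p | O1, O2) = P(\<Delta>g p | \<Delta>g O1, \<Delta>g O2)\<close>, for distributions
  that need not have a density, says that the law on the right is the image under \<open>\<Delta>g\<close> of the
  law on the left.\<close>

definition equivariant_origin_selection ::
    "((real^3) set \<Rightarrow> (real^3) set \<Rightarrow> (real^3) measure) \<Rightarrow> bool" where
  "equivariant_origin_selection P \<longleftrightarrow>
     (\<forall>\<Delta>g\<in>SE3. \<forall>g0\<in>SE3. \<forall>Os\<in>point_clouds. \<forall>Oe\<in>point_clouds.
        distr (P (cloud_act (se3_inv g0) Os) Oe) borel (se3_act \<Delta>g) =
        P (cloud_act (se3_mult \<Delta>g (se3_inv g0)) Os) (cloud_act \<Delta>g Oe))"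

text \<open>The law \<open>P(p | O1, O2) \<delta>(R)\<close> on \<open>SE(3)\<close>.\<close>

definition frame_selection ::
    "((real^3) set \<Rightarrow> (real^3) set \<Rightarrow> (real^3) measure) \<Rightarrow>
     (real^3) set \<Rightarrow> (real^3) set \<Rightarrow> rigid measure" where
  "frame_selection P O1 O2 = P O1 O2 \<Otimes>\<^sub>M return SO3_borel (mat 1)"

definition diffusion_kernel ::
    "((real^3) set \<Rightarrow> (real^3) set \<Rightarrow> rigid measure) \<Rightarrow> real \<Rightarrow>
     rigid \<Rightarrow> rigid \<Rightarrow> (real^3) set \<Rightarrow> (real^3) set \<Rightarrow> real" where
  "diffusion_kernel F t g g0 Os Oe =
     (LINT ged | F (cloud_act (se3_inv g0) Os) Oe.
        brownian_kernel t
          (se3_mult (se3_mult (se3_mult (se3_inv ged) (se3_inv g0)) g) ged))"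

definition square_integrable :: "'a measure \<Rightarrow> ('a \<Rightarrow> real) \<Rightarrow> bool" where
  "square_integrable M f \<longleftrightarrow> f \<in> borel_measurable M \<and> integrable M (\<lambda>x. (f x)\<^sup>2)"

definition bi_equivariant ::
    "(rigid \<Rightarrow> rigid \<Rightarrow> (real^3) set \<Rightarrow> (real^3) set \<Rightarrow> real) \<Rightarrow> bool" where
  "bi_equivariant K \<longleftrightarrow>
     (\<forall>g0\<in>SE3. \<forall>Os\<in>point_clouds. \<forall>Oe\<in>point_clouds.
        square_integrable SE3_haar (\<lambda>g. K g g0 Os Oe)) \<and>
     (\<forall>\<Delta>g\<in>SE3. \<forall>g0\<in>SE3. \<forall>Os\<in>point_clouds. \<forall>Oe\<in>point_clouds.
        AE g in SE3_haar.
          K g g0 Os Oe = K (se3_mult \<Delta>g g) (se3_mult \<Delta>g g0) (cloud_act \<Delta>g Os) Oe \<and>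
          K g g0 Os Oe =
            K (se3_mult g (se3_inv \<Delta>g)) (se3_mult g0 (se3_inv \<Delta>g)) Os (cloud_act \<Delta>g Oe))"

section \<open>Existence and uniqueness of the normalized Haar measure on \<open>SO(3)\<close>\<close>

lemma continuous_on_matrix_matrix_mult:
  fixes f g :: "'a::topological_space \<Rightarrow> real^3^3"
  assumes "continuous_on S f" "continuous_on S g"
  shows "continuous_on S (\<lambda>x. f x ** g x)"
  unfolding matrix_matrix_mult_def
  by (intro continuous_intros assms)

lemma space_SO3_borel: "space SO3_borel = SO3"
  by (simp add: SO3_borel_def space_restrict_space)

lemma SO3_mult_measurable:
  "(\<lambda>(x, y). x ** y) \<in> SO3_borel \<Otimes>\<^sub>M SO3_borel \<rightarrow>\<^sub>M SO3_borel"
proof -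
  have "(\<lambda>z::(real^3^3) \<times> (real^3^3). fst z ** snd z) \<in> borel \<rightarrow>\<^sub>M borel"
    by (intro borel_measurable_continuous_onI continuous_on_matrix_matrix_mult continuous_intros)
  then have *: "(\<lambda>z::(real^3^3) \<times> (real^3^3). fst z ** snd z) \<in> borel \<Otimes>\<^sub>M borel \<rightarrow>\<^sub>M borel"
    by (simp add: borel_prod)
  have id: "(\<lambda>x. x) \<in> SO3_borel \<rightarrow>\<^sub>M borel"
    by (simp add: SO3_borel_def measurable_restrict_space1)
  have "(\<lambda>z. (fst z, snd z)) \<in> SO3_borel \<Otimes>\<^sub>M SO3_borel \<rightarrow>\<^sub>M borel \<Otimes>\<^sub>M borel"
    by (intro measurable_Pair measurable_compose[OF measurable_fst id]
        measurable_compose[OF measurable_snd id])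
  from measurable_compose[OF this *]
  have "(\<lambda>z. fst z ** snd z) \<in> SO3_borel \<Otimes>\<^sub>M SO3_borel \<rightarrow>\<^sub>M borel"
    by simp
  moreover have "(\<lambda>z. fst z ** snd z) \<in> space (SO3_borel \<Otimes>\<^sub>M SO3_borel) \<rightarrow> SO3"
    by (auto simp: space_pair_measure space_SO3_borel SO3_mult)
  ultimately show ?thesis
    by (simp add: SO3_borel_def measurable_restrict_space2_iff case_prod_beta')
qed

lemma SO3_left_measurable: "Q \<in> SO3 \<Longrightarrow> (\<lambda>R. Q ** R) \<in> SO3_borel \<rightarrow>\<^sub>M SO3_borel"
  using measurable_compose[OF measurable_Pair1'[of Q SO3_borel SO3_borel] SO3_mult_measurable]
  by (simp add: space_SO3_borel)

lemma SO3_right_measurable: "Q \<in> SO3 \<Longrightarrow> (\<lambda>R. R ** Q) \<in> SO3_borel \<rightarrow>\<^sub>M SO3_borel"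
  using measurable_compose[OF measurable_Pair2'[of Q SO3_borel SO3_borel] SO3_mult_measurable]
  by (simp add: space_SO3_borel)

lemma SO3_transpose_measurable: "transpose \<in> SO3_borel \<rightarrow>\<^sub>M SO3_borel"
proof -
  have "(transpose :: real^3^3 \<Rightarrow> _) \<in> borel \<rightarrow>\<^sub>M borel"
    unfolding transpose_def
    by (intro borel_measurable_continuous_onI continuous_intros)
  then show ?thesis
    using SO3_transpose unfolding SO3_borel_def
    by (auto simp: measurable_restrict_space2_iff measurable_restrict_space1 space_restrict_space)
qed

lemma haar_SO3_left_right_eq:
  assumes M: "sets M = sets SO3_borel" "prob_space M"
    and left: "\<And>Q. Q \<in> SO3 \<Longrightarrow> distr M M (\<lambda>R. Q ** R) = M"
    and N: "sets N = sets SO3_borel" "prob_space N"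
    and right: "\<And>Q. Q \<in> SO3 \<Longrightarrow> distr N N (\<lambda>R. R ** Q) = N"
  shows "M = N"
proof (rule measure_eqI)
  show "sets M = sets N"
    using M N by simp
  fix A assume "A \<in> sets M"
  then have A: "A \<in> sets SO3_borel" "A \<in> sets M" "A \<in> sets N"
    using M N by auto
  interpret M: prob_space M by fact
  interpret N: prob_space N by fact
  interpret P: pair_sigma_finite N M ..
  have sp: "space M = SO3" "space N = SO3"
    using sets_eq_imp_space_eq[OF M(1)] sets_eq_imp_space_eq[OF N(1)]
    by (simp_all add: space_SO3_borel)
  have mM: "M \<rightarrow>\<^sub>M K = SO3_borel \<rightarrow>\<^sub>M K" "L \<rightarrow>\<^sub>M M = L \<rightarrow>\<^sub>M SO3_borel"
    "N \<rightarrow>\<^sub>M K = SO3_borel \<rightarrow>\<^sub>M K" "L \<rightarrow>\<^sub>M N = L \<rightarrow>\<^sub>M SO3_borel"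
    for K :: "'k measure" and L :: "'l measure"
    using M(1) N(1) by (auto intro!: measurable_cong_sets)
  have pair: "sets (N \<Otimes>\<^sub>M M) = sets (SO3_borel \<Otimes>\<^sub>M SO3_borel)"
    by (rule sets_pair_measure_cong) (use M N in auto)
  have meas: "(\<lambda>(x, y). indicator A (x ** y) :: ennreal) \<in> borel_measurable (N \<Otimes>\<^sub>M M)"
    unfolding measurable_cong_sets[OF pair refl]
    using measurable_compose[OF SO3_mult_measurable borel_measurable_indicator[OF A(1)]]
    by (simp add: case_prod_beta')
  have 1: "(\<integral>\<^sup>+y. indicator A (x ** y) \<partial>M) = emeasure M A" if "x \<in> SO3" for x
  proof -
    have "emeasure M A = (\<integral>\<^sup>+y. indicator A y \<partial>distr M M (\<lambda>R. x ** R))"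
      using left[OF that] A by simp
    also have "\<dots> = (\<integral>\<^sup>+y. indicator A (x ** y) \<partial>M)"
      by (rule nn_integral_distr) (use SO3_left_measurable[OF that] A in \<open>auto simp: mM\<close>)
    finally show ?thesis ..
  qed
  have 2: "(\<integral>\<^sup>+x. indicator A (x ** y) \<partial>N) = emeasure N A" if "y \<in> SO3" for y
  proof -
    have "emeasure N A = (\<integral>\<^sup>+x. indicator A x \<partial>distr N N (\<lambda>R. R ** y))"
      using right[OF that] A by simp
    also have "\<dots> = (\<integral>\<^sup>+x. indicator A (x ** y) \<partial>N)"
      by (rule nn_integral_distr) (use SO3_right_measurable[OF that] A in \<open>auto simp: mM\<close>)
    finally show ?thesis ..
  qed
  have "emeasure M A = (\<integral>\<^sup>+x. emeasure M A \<partial>N)"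
    by (simp add: N.emeasure_space_1)
  also have "\<dots> = (\<integral>\<^sup>+x. \<integral>\<^sup>+y. indicator A (x ** y) \<partial>M \<partial>N)"
    by (rule nn_integral_cong) (simp add: sp 1)
  also have "\<dots> = (\<integral>\<^sup>+y. \<integral>\<^sup>+x. indicator A (x ** y) \<partial>N \<partial>M)"
    using P.Fubini[OF meas] by simp
  also have "\<dots> = (\<integral>\<^sup>+y. emeasure N A \<partial>M)"
    by (rule nn_integral_cong) (simp add: sp 2)
  also have "\<dots> = emeasure N A"
    by (simp add: M.emeasure_space_1)
  finally show "emeasure M A = emeasure N A" .
qed

lemma normalized_haar_SO3_unique:
  "normalized_haar_SO3 M \<Longrightarrow> normalized_haar_SO3 N \<Longrightarrow> M = N"
  unfolding normalized_haar_SO3_def by (rule haar_SO3_left_right_eq) simp_all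

text \<open>For existence, a pair of vectors drawn uniformly from a bounded rotation invariant set is
  turned into a positively oriented orthonormal frame. This gives a left invariant law; it is also
  right invariant, since it agrees with its image under inversion.\<close>

lemma lborel_distr_rotation:
  fixes Q :: "real^3^3"
  assumes Q: "Q \<in> SO3"
  shows "distr lborel borel (\<lambda>x. Q *v x) = lborel"
proof (rule sym, rule lborel_eqI)
  fix l u :: "real^3"
  assume le: "\<And>b. b \<in> Basis \<Longrightarrow> l \<bullet> b \<le> u \<bullet> b"
  have orth: "orthogonal_transformation (\<lambda>x. transpose Q *v x)"
    using SO3_orthogonal[OF SO3_transpose[OF Q]]
    by (simp add: orthogonal_transformation_matrix matrix_vector_mul_linear
        del: transpose_matrix_vector)
  have meas: "(\<lambda>x. Q *v x) \<in> borel \<rightarrow>\<^sub>M borel"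
    by (intro borel_measurable_continuous_onI) (rule linear_continuous_on[OF matrix_vector_mul_bounded_linear])
  have inv: "transpose Q *v (Q *v x) = x" "Q *v (transpose Q *v x) = x" for x
    unfolding matrix_vector_mul_assoc SO3_transpose_mult[OF Q] by simp_all
  have vim: "(\<lambda>x. Q *v x) -` box l u = (\<lambda>x. transpose Q *v x) ` box l u" (is "?V = ?I")
  proof (intro equalityI subsetI)
    fix x assume "x \<in> ?V"
    then have "Q *v x \<in> box l u" by (rule vimageD)
    with inv(1)[of x, symmetric] show "x \<in> ?I" by (rule image_eqI)
  next
    fix x assume "x \<in> ?I"
    then obtain y where "y \<in> box l u" "x = transpose Q *v y" by (rule imageE)
    then show "x \<in> ?V" unfolding vimage_eq using inv(2)[of y] by metis
  qed
  have bl: "box l u \<in> lmeasurable" by simp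
  have V: "?V \<in> sets borel"
    using measurable_sets[OF meas, of "box l u"] by simp
  have "emeasure (distr lborel borel (\<lambda>x. Q *v x)) (box l u) = emeasure lborel ?V"
    by (subst emeasure_distr) (simp_all add: meas)
  also have "\<dots> = emeasure lebesgue ?V"
    by (metis V emeasure_completion main_part_sets sets_lborel sets_completionI_sets main_part)
  also have "\<dots> = ennreal (measure lebesgue ?I)"
    unfolding vim by (rule emeasure_eq_measure2[OF measurable_orthogonal_image[OF orth bl]])
  also have "\<dots> = ennreal (measure lebesgue (box l u))"
    unfolding measure_orthogonal_image[OF orth bl] ..
  also have "\<dots> = ennreal (\<Prod>b\<in>Basis. (u - l) \<bullet> b)"
    using le by simp
  finally show "emeasure (distr lborel borel (\<lambda>x. Q *v x)) (box l u) =
      ennreal (\<Prod>b\<in>Basis. (u - l) \<bullet> b)" .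
qed simp

definition unit_vec :: "real^3 \<Rightarrow> real^3" where
  "unit_vec x = (1 / norm x) *\<^sub>R x"

definition frame_of :: "(real^3) \<times> (real^3) \<Rightarrow> real^3^3" where
  "frame_of z =
     (let u = unit_vec (fst z); w = unit_vec (cross3 (fst z) (snd z))
      in transpose (vector [u, cross3 w u, w]))"

definition frame_dom :: "((real^3) \<times> (real^3)) set" where
  "frame_dom = {z. norm (fst z) < 1 \<and> norm (snd z) < 1 \<and> cross3 (fst z) (snd z) \<noteq> 0}"

lemma SO3_norm: "Q \<in> SO3 \<Longrightarrow> norm (Q *v x) = norm x"
  using SO3_orthogonal[of Q] orthogonal_transformation_norm[of "(*v) Q" x]
  by (simp add: orthogonal_transformation_matrix)

lemma SO3_cross: "Q \<in> SO3 \<Longrightarrow> cross3 (Q *v x) (Q *v y) = Q *v cross3 x y"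
  by (simp add: SO3_def cross_rotation_matrix)

lemma SO3_eq_0_iff: "Q \<in> SO3 \<Longrightarrow> Q *v x = 0 \<longleftrightarrow> x = 0"
  using SO3_norm[of Q x] by (metis norm_eq_zero)

lemma frame_of_in_SO3:
  assumes "z \<in> frame_dom"
  shows "frame_of z \<in> SO3"
proof -
  define u w where "u = unit_vec (fst z)" and "w = unit_vec (cross3 (fst z) (snd z))"
  define A where "A = (vector [u, cross3 w u, w] :: real^3^3)"
  have nz: "cross3 (fst z) (snd z) \<noteq> 0" "fst z \<noteq> 0"
    using assms by (auto simp: frame_dom_def)
  have unit: "norm (unit_vec x) = 1" if "x \<noteq> 0" for x
    using that by (simp add: unit_vec_def)
  have uu: "u \<bullet> u = 1" and ww: "w \<bullet> w = 1"
    using unit nz by (simp_all add: u_def w_def norm_eq_1)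
  have uw: "u \<bullet> w = 0"
    by (simp add: u_def w_def unit_vec_def dot_cross_self)
  have vv: "cross3 w u \<bullet> cross3 w u = 1"
    using uu ww uw by (simp add: dot_cross inner_commute)
  have rows: "vector [a, b, c] ** transpose (vector [a, b, c]) = (mat 1 :: real^3^3)"
    if "a \<bullet> a = 1" "b \<bullet> b = 1" "c \<bullet> c = 1" "a \<bullet> b = 0" "a \<bullet> c = 0" "b \<bullet> c = 0"
    for a b c :: "real^3"
    using that
    by (simp add: vec_eq_iff matrix_matrix_mult_def transpose_def mat_def forall_3
        inner_vec_def sum_3 mult.commute)
  have "A ** transpose A = mat 1"
    unfolding A_def by (rule rows) (simp_all add: uu ww uw vv dot_cross_self)
  then have "orthogonal_matrix A"
    by (metis orthogonal_matrix orthogonal_matrix_transpose transpose_transpose)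
  moreover have "det A = 1"
  proof -
    have "cross3 (cross3 w u) w = (w \<bullet> w) *\<^sub>R u - (u \<bullet> w) *\<^sub>R w"
      by (simp add: cross3_simps vec_eq_iff forall_3)
    then have "cross3 (cross3 w u) w = u"
      by (simp add: ww uw)
    then show ?thesis
      using dot_cross_det[of u "cross3 w u" w] uu by (simp add: A_def)
  qed
  ultimately have "transpose A \<in> SO3"
    by (simp add: SO3_def rotation_matrix_def det_transpose)
  then show ?thesis
    by (simp add: frame_of_def A_def u_def w_def Let_def)
qed

lemma frame_of_rotation:
  assumes Q: "Q \<in> SO3"
  shows "frame_of (Q *v fst z, Q *v snd z) = Q ** frame_of z"
proof -
  have unit: "unit_vec (Q *v x) = Q *v unit_vec x" for x
    using linear_cmul[OF matrix_vector_mul_linear[of Q]] by (simp add: unit_vec_def SO3_norm[OF Q])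
  have cols: "transpose (vector [Q *v a, Q *v b, Q *v c] :: real^3^3) =
      Q ** transpose (vector [a, b, c])"
    for a b c :: "real^3"
  proof -
    have "transpose (vector [Q *v a, Q *v b, Q *v c] :: real^3^3) $ i $ j =
        (Q ** transpose (vector [a, b, c])) $ i $ j" for i j
      using exhaust_3[of j]
      by (auto simp: matrix_matrix_mult_def matrix_vector_mult_def transpose_def)
    then show ?thesis
      by (simp add: vec_eq_iff)
  qed
  show ?thesis
    by (simp add: frame_of_def Let_def unit SO3_cross[OF Q] cols)
qed

lemma frame_dom_rotation:
  "Q \<in> SO3 \<Longrightarrow> (Q *v fst z, Q *v snd z) \<in> frame_dom \<longleftrightarrow> z \<in> frame_dom"
  by (simp add: frame_dom_def SO3_norm SO3_cross SO3_eq_0_iff)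

lemma open_frame_dom: "open frame_dom"
  unfolding frame_dom_def
  by (intro open_Collect_conj open_Collect_less open_Collect_neq continuous_on_cross
      continuous_intros)

lemma emeasure_frame_dom: "emeasure lborel frame_dom \<noteq> 0" "emeasure lborel frame_dom \<noteq> \<infinity>"
proof -
  have "((1 / 2) *\<^sub>R axis 1 1, (1 / 2) *\<^sub>R axis 2 1) \<in> frame_dom"
    by (auto simp: frame_dom_def cross3_def vec_eq_iff forall_3 axis_def[of 1] axis_def[of 2]
        norm_vec_def L2_set_def sum_3 power2_eq_square)
  then have "\<not> negligible frame_dom"
    using open_not_negligible[OF open_frame_dom] by blast
  then show "emeasure lborel frame_dom \<noteq> 0"
    using open_frame_dom
    by (auto simp: negligible_iff_null_sets null_sets_completion_iff null_sets_def)
  have "frame_dom \<subseteq> ball 0 1 \<times> ball 0 1"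
    by (auto simp: frame_dom_def)
  then have "bounded frame_dom"
    by (rule bounded_subset[rotated]) (intro bounded_Times bounded_ball)
  then show "emeasure lborel frame_dom \<noteq> \<infinity>"
    using emeasure_bounded_finite[of frame_dom] by simp
qed

lemma continuous_on_frame_of: "continuous_on frame_dom frame_of"
proof -
  have u: "continuous_on frame_dom (\<lambda>z. unit_vec (fst z))"
    unfolding unit_vec_def by (intro continuous_intros) (auto simp: frame_dom_def)
  have w: "continuous_on frame_dom (\<lambda>z. unit_vec (cross3 (fst z) (snd z)))"
    unfolding unit_vec_def
    by (intro continuous_intros continuous_on_cross) (auto simp: frame_dom_def)
  have vec: "continuous_on frame_dom (\<lambda>z. vector [a z, b z, c z] $ i)"
    if "continuous_on frame_dom a" "continuous_on frame_dom b" "continuous_on frame_dom c"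
    for a b c :: "(real^3) \<times> (real^3) \<Rightarrow> real^3" and i :: 3
    using that exhaust_3[of i] by auto
  show ?thesis
    unfolding frame_of_def Let_def transpose_def
    by (intro continuous_on_vec_lambda continuous_on_component vec continuous_on_cross u w)
qed

lemma lborel_distr_rotation_pair:
  assumes Q: "Q \<in> SO3"
  shows "distr lborel borel (\<lambda>z. (Q *v fst z, Q *v snd z)) = lborel"
proof -
  have "(\<lambda>x. Q *v x) \<in> borel \<rightarrow>\<^sub>M borel"
    by (intro borel_measurable_continuous_onI)
      (rule linear_continuous_on[OF matrix_vector_mul_bounded_linear])
  then have meas: "(\<lambda>x. Q *v x) \<in> lborel \<rightarrow>\<^sub>M borel"
    by simp
  have "distr lborel borel (\<lambda>x. Q *v x) \<Otimes>\<^sub>M distr lborel borel (\<lambda>x. Q *v x) =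
      distr (lborel \<Otimes>\<^sub>M lborel) (borel \<Otimes>\<^sub>M borel) (\<lambda>(x, y). (Q *v x, Q *v y))"
    by (intro pair_measure_distr meas)
      (simp add: lborel_distr_rotation[OF Q] lborel.sigma_finite_measure_axioms)
  then show ?thesis
    by (simp add: lborel_distr_rotation[OF Q] lborel_prod borel_prod case_prod_beta')
qed

lemma left_haar_SO3_exists:
  obtains M where "sets M = sets SO3_borel" "prob_space M"
    "\<And>Q. Q \<in> SO3 \<Longrightarrow> distr M M (\<lambda>R. Q ** R) = M"
proof
  define fr where "fr z = (if z \<in> frame_dom then frame_of z else mat 1)" for z
  define L where "L = uniform_measure lborel frame_dom"
  define M where "M = distr L SO3_borel fr"
  have dom: "frame_dom \<in> sets borel"
    using open_frame_dom by simp
  have "fr \<in> borel \<rightarrow>\<^sub>M borel"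
    unfolding fr_def
    by (intro borel_measurable_continuous_on_if dom continuous_on_frame_of continuous_on_const)
  moreover have "fr z \<in> SO3" for z
    by (simp add: fr_def frame_of_in_SO3 SO3_one)
  ultimately have fr_borel: "fr \<in> borel \<rightarrow>\<^sub>M SO3_borel"
    by (simp add: SO3_borel_def measurable_restrict_space2_iff)
  have setsL: "sets L = sets borel"
    by (simp add: L_def)
  have fr: "fr \<in> L \<rightarrow>\<^sub>M SO3_borel"
    using fr_borel by (simp add: measurable_cong_sets[OF setsL refl])
  show sets: "sets M = sets SO3_borel"
    by (simp add: M_def)
  have L: "prob_space L"
    unfolding L_def by (rule prob_space_uniform_measure[OF emeasure_frame_dom])
  show "prob_space M"
    unfolding M_def by (rule prob_space.prob_space_distr[OF L fr])
  fix Q assume Q: "Q \<in> SO3"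
  let ?F = "\<lambda>z. (Q *v fst z, Q *v snd z)"
  have F: "?F \<in> borel \<rightarrow>\<^sub>M borel"
    by (intro borel_measurable_continuous_onI continuous_intros
        linear_continuous_on_compose[OF _ matrix_vector_mul_linear])
  have lQ: "(\<lambda>R. Q ** R) \<in> SO3_borel \<rightarrow>\<^sub>M SO3_borel"
    by (rule SO3_left_measurable[OF Q])
  have L_eq: "emeasure L B = emeasure lborel (frame_dom \<inter> B) / emeasure lborel frame_dom"
    if "B \<in> sets borel" for B
    using that dom by (simp add: L_def)
  have "distr M M (\<lambda>R. Q ** R) = distr M SO3_borel (\<lambda>R. Q ** R)"
    by (rule distr_cong) (simp_all add: sets)
  also have "\<dots> = distr L SO3_borel (\<lambda>z. Q ** fr z)"
    unfolding M_def by (subst distr_distr[OF lQ fr]) (simp add: comp_def)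
  also have "\<dots> = M"
  proof (rule measure_eqI)
    show "sets (distr L SO3_borel (\<lambda>z. Q ** fr z)) = sets M"
      by (simp add: sets)
    fix A assume "A \<in> sets (distr L SO3_borel (\<lambda>z. Q ** fr z))"
    then have A: "A \<in> sets SO3_borel" by simp
    have Qfr: "(\<lambda>z. Q ** fr z) \<in> borel \<rightarrow>\<^sub>M SO3_borel"
      by (rule measurable_compose[OF fr_borel lQ])
    have B1: "fr -` A \<in> sets borel" and B2: "(\<lambda>z. Q ** fr z) -` A \<in> sets borel"
      using measurable_sets[OF fr_borel A] measurable_sets[OF Qfr A] by simp_all
    have B3: "frame_dom \<inter> fr -` A \<in> sets borel"
      using dom B1 by (rule sets.Int)
    have "emeasure lborel (frame_dom \<inter> fr -` A) =
        emeasure (distr lborel borel ?F) (frame_dom \<inter> fr -` A)"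
      by (simp add: lborel_distr_rotation_pair[OF Q])
    also have "\<dots> = emeasure lborel (?F -` (frame_dom \<inter> fr -` A))"
      using F B3 by (subst emeasure_distr) simp_all
    also have "?F -` (frame_dom \<inter> fr -` A) = frame_dom \<inter> (\<lambda>z. Q ** fr z) -` A"
      using frame_dom_rotation[OF Q] frame_of_rotation[OF Q] by (auto simp: fr_def)
    finally have eq: "emeasure lborel (frame_dom \<inter> fr -` A) =
        emeasure lborel (frame_dom \<inter> (\<lambda>z. Q ** fr z) -` A)" .
    have sp: "space L = UNIV"
      using sets_eq_imp_space_eq[OF setsL] by simp
    have "emeasure (distr L SO3_borel (\<lambda>z. Q ** fr z)) A = emeasure L ((\<lambda>z. Q ** fr z) -` A)"
      using measurable_compose[OF fr lQ] A sp by (subst emeasure_distr) simp_all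
    also have "\<dots> = emeasure L (fr -` A)"
      by (simp add: L_eq B1 B2 eq)
    also have "\<dots> = emeasure M A"
      unfolding M_def using fr A sp by (subst emeasure_distr) simp_all
    finally show "emeasure (distr L SO3_borel (\<lambda>z. Q ** fr z)) A = emeasure M A" .
  qed
  finally show "distr M M (\<lambda>R. Q ** R) = M" .
qed

lemma normalized_haar_SO3_exists: "\<exists>M. normalized_haar_SO3 M"
proof -
  obtain M where M: "sets M = sets SO3_borel" "prob_space M"
    and left: "\<And>Q. Q \<in> SO3 \<Longrightarrow> distr M M (\<lambda>R. Q ** R) = M"
    using left_haar_SO3_exists by blast
  define N where "N = distr M M transpose"
  have meas: "M \<rightarrow>\<^sub>M M = SO3_borel \<rightarrow>\<^sub>M SO3_borel"
    using M(1) by (intro measurable_cong_sets) auto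
  have t: "transpose \<in> M \<rightarrow>\<^sub>M M"
    using SO3_transpose_measurable by (simp add: meas)
  have N: "sets N = sets M" "prob_space N"
    using prob_space.prob_space_distr[OF M(2) t] by (simp_all add: N_def)
  have right: "distr N N (\<lambda>R. R ** Q) = N" if Q: "Q \<in> SO3" for Q
  proof -
    have r: "(\<lambda>R. R ** Q) \<in> M \<rightarrow>\<^sub>M M" and l: "(\<lambda>R. transpose Q ** R) \<in> M \<rightarrow>\<^sub>M M"
      using SO3_right_measurable[OF Q] SO3_left_measurable[OF SO3_transpose[OF Q]]
      by (simp_all add: meas)
    have "distr N N (\<lambda>R. R ** Q) = distr N M (\<lambda>R. R ** Q)"
      by (rule distr_cong) (simp_all add: N)
    also have "\<dots> = distr M M ((\<lambda>R. R ** Q) \<circ> transpose)"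
      unfolding N_def by (rule distr_distr[OF r t])
    also have "(\<lambda>R. R ** Q) \<circ> transpose = transpose \<circ> (\<lambda>R. transpose Q ** R)"
      by (simp add: fun_eq_iff matrix_transpose_mul)
    also have "distr M M \<dots> = distr (distr M M (\<lambda>R. transpose Q ** R)) M transpose"
      by (rule distr_distr[OF t l, symmetric])
    also have "\<dots> = N"
      unfolding N_def left[OF SO3_transpose[OF Q]] ..
    finally show ?thesis .
  qed
  have "M = N"
    by (rule haar_SO3_left_right_eq[OF M left _ N(2) right]) (simp_all add: N M)
  with M left right show ?thesis
    unfolding normalized_haar_SO3_def by auto
qed

lemma normalized_haar_SO3_haar: "normalized_haar_SO3 SO3_haar"
  unfolding SO3_haar_def
  using normalized_haar_SO3_exists normalized_haar_SO3_unique by (metis (no_types, lifting) theI)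

lemma sets_SO3_haar: "sets SO3_haar = sets SO3_borel"
  and prob_space_SO3_haar: "prob_space SO3_haar"
  using normalized_haar_SO3_haar by (auto simp: normalized_haar_SO3_def)

lemma space_SE3_haar: "space SE3_haar = SE3"
  using sets_eq_imp_space_eq[OF sets_SO3_haar]
  by (simp add: SE3_haar_def space_pair_measure SE3_def space_SO3_borel)

end

theory Submission
  imports Defs "HOL-Real_Asymp.Real_Asymp"
begin

text \<open>Put \<open>h = g0\<inverse> g\<close>. Conjugation by a rigid motion \<open>e\<close> with translation part \<open>p\<close> turns the
  translation part of \<open>h\<close> into a rotated copy of the displacement \<open>h p - p\<close> and preserves the
  rotation angle, so the diffusion kernel equals \<open>IG(h) \<integral> N(h p - p) dP(p)\<close>. Left equivariance is
  clear, as \<open>h\<close> does not change; right equivariance holds since \<open>\<Delta>g h \<Delta>g\<inverse>\<close> displaces \<open>\<Delta>g p\<close> by the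
  rotated vector \<open>h p - p\<close>. As \<open>IG\<close> and \<open>N\<close> are bounded, the square of the kernel is at most a
  constant times \<open>\<integral> N(h p - p) dP(p)\<close>, whose integral over \<open>g\<close> is finite by Tonelli's theorem and
  translation invariance.\<close>

section \<open>The Brownian kernel\<close>

lemma abs_sin_nat_mult_le: "\<bar>sin (real n * x)\<bar> \<le> real n * \<bar>sin x\<bar>"
proof (induction n)
  case (Suc n)
  have "\<bar>sin (real (Suc n) * x)\<bar> = \<bar>sin (real n * x) * cos x + cos (real n * x) * sin x\<bar>"
    by (simp add: distrib_right sin_add algebra_simps)
  also have "\<dots> \<le> \<bar>sin (real n * x)\<bar> * \<bar>cos x\<bar> + \<bar>cos (real n * x)\<bar> * \<bar>sin x\<bar>"
    by (metis abs_mult abs_triangle_ineq)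
  also have "\<dots> \<le> \<bar>sin (real n * x)\<bar> * 1 + 1 * \<bar>sin x\<bar>"
    by (intro add_mono mult_left_mono mult_right_mono) auto
  finally show ?case
    using Suc by (simp add: distrib_right)
qed simp

text \<open>The numerator is sin((2l + 1) x) with x = \<theta> / 2, an integer multiple of the angle
  in the denominator, so \<open>abs_sin_nat_mult_le\<close> cancels the denominator.\<close>

lemma abs_sine_quotient_le: "\<bar>sine_quotient l \<theta>\<bar> \<le> 2 * real l + 1"
proof -
  have "real l * \<theta> + \<theta> / 2 = real (2 * l + 1) * (\<theta> / 2)"
    by (simp add: field_simps)
  then have "\<bar>sin (real l * \<theta> + \<theta> / 2)\<bar> \<le> real (2 * l + 1) * \<bar>sin (\<theta> / 2)\<bar>"
    using abs_sin_nat_mult_le[of "2 * l + 1" "\<theta> / 2"] by metis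
  then show ?thesis
    \<comment> \<open>At \<theta> = 0 the bound is attained; at the other zeros of the denominator
      the quotient is 0, as division by zero yields 0.\<close>
    by (cases "sin (\<theta> / 2) = 0") (auto simp: sine_quotient_def field_simps)
qed

text \<open>Weierstrass majorant: one factor 2l + 1 is explicit, the other bounds the sine quotient,
  and the exponential makes the majorant summable, uniformly in \<open>R\<close>.\<close>

lemma bounded_IG_SO3:
  assumes "\<epsilon> > 0"
  obtains C where "\<And>R. \<bar>IG_SO3 \<epsilon> R\<bar> \<le> C"
proof -
  define b where "b l = (2 * real l + 1)\<^sup>2 * exp (- \<epsilon> * real l * (real l + 1))" for l
  have "b \<in> O(\<lambda>l. inverse (real l ^ 2))"
    using assms unfolding b_def by real_asymp
  then have b: "summable b"
    by (rule summable_comparison_test_bigo[rotated])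
      (use inverse_power_summable[of 2, where 'a = real] in simp)
  have le: "norm ((2 * real l + 1) * exp (- \<epsilon> * real l * (real l + 1)) *
      sine_quotient l (rotation_angle R)) \<le> b l" for l R
    unfolding b_def power2_eq_square real_norm_def abs_mult
    using mult_left_mono[OF abs_sine_quotient_le[of l "rotation_angle R"],
        of "(2 * real l + 1) * exp (- \<epsilon> * real l * (real l + 1))"]
    by (simp add: mult_ac)
  have "\<bar>IG_SO3 \<epsilon> R\<bar> \<le> suminf b" for R
    unfolding IG_SO3_def real_norm_def[symmetric] by (rule norm_suminf_le[OF le b])
  then show ?thesis
    using that by blast
qed

text \<open>Outside \<open>[-1, 1]\<close> the value of \<open>arccos\<close> is \<open>THE x. False\<close>, so it is constant there.\<close>

lemma borel_measurable_arccos: "(arccos :: real \<Rightarrow> real) \<in> borel_measurable borel"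
proof -
  have "arccos y = (THE x. False)" if "y \<notin> {-1..1}" for y
  proof -
    have "(\<lambda>x. 0 \<le> x \<and> x \<le> pi \<and> cos x = y) = (\<lambda>x. False)"
      using that by auto
    then show ?thesis
      unfolding arccos_def by (rule arg_cong)
  qed
  then have "arccos = (\<lambda>y. if y \<in> {-1..1} then arccos y else (THE x. False))"
    by auto
  moreover have "(\<lambda>y. if y \<in> {-1..1} then arccos y else (THE x. False)) \<in> borel_measurable borel"
    by (intro borel_measurable_continuous_on_if continuous_on_arccos' continuous_on_const) auto
  ultimately show ?thesis
    by simp
qed

text \<open>The claim concerns all 3x3 matrices, where (tr R - 1) / 2 can leave [-1, 1]; hence the
  treatment of \<open>arccos\<close> on the whole line.\<close>

lemma borel_measurable_IG_SO3: "IG_SO3 \<epsilon> \<in> borel_measurable borel"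
proof -
  have "(trace :: real^3^3 \<Rightarrow> real) \<in> borel_measurable borel"
    unfolding trace_def by (intro borel_measurable_continuous_onI continuous_intros)
  note [measurable] = this borel_measurable_arccos
  have [measurable]: "rotation_angle \<in> borel_measurable borel"
    unfolding rotation_angle_def by measurable
  have [measurable]: "sine_quotient l \<in> borel_measurable borel" for l
    unfolding sine_quotient_def by measurable
  show ?thesis
    unfolding IG_SO3_def by measurable
qed

section \<open>The isotropic Gaussian factor\<close>

lemma mvnormal_density_scaled_identity:
  fixes p :: "real^'n"
  assumes "t > 0"
  shows "mvnormal_density 0 (t *\<^sub>R mat 1) p =
    exp (- (norm p)\<^sup>2 / (2 * t)) / sqrt ((2 * pi) ^ CARD('n) * det (t *\<^sub>R mat 1 :: real^'n^'n))"
proof -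
  let ?A = "t *\<^sub>R mat 1 :: real^'n^'n"
  \<comment> \<open>\<open>matrix_inv\<close> is a Hilbert choice: one explicit two-sided inverse
    shows that the chosen matrix is an inverse, and cancelling \<open>t\<close> then identifies
    it.\<close>
  have "?A ** ((1 / t) *\<^sub>R mat 1) = mat 1 \<and> ((1 / t) *\<^sub>R mat 1) ** ?A = mat 1"
    using assms by (simp add: scalar_matrix_assoc[symmetric] matrix_scalar_ac)
  then have "?A ** matrix_inv ?A = mat 1 \<and> matrix_inv ?A ** ?A = mat 1"
    unfolding matrix_inv_def by (rule someI)
  then have "t *\<^sub>R matrix_inv ?A = mat 1"
    by (simp add: scalar_matrix_assoc[symmetric])
  then have "matrix_inv ?A = (1 / t) *\<^sub>R mat 1"
    using assms by (metis divide_inverse mult_1 inverse_eq_divide scaleR_scaleR scaleR_one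
        left_inverse less_irrefl)
  then show ?thesis
    using assms
    by (simp add: mvnormal_density_def scaleR_matrix_vector_assoc[symmetric]
        power2_norm_eq_inner field_simps)
qed

lemma det_scaled_identity_pos: "t > 0 \<Longrightarrow> det (t *\<^sub>R mat 1 :: real^'n^'n) > 0"
  by (subst det_diagonal) (auto simp: mat_def intro: prod_pos)

lemma mvnormal_density_nonneg:
  assumes "t > 0"
  shows "0 \<le> mvnormal_density 0 (t *\<^sub>R mat 1) (p :: real^'n)"
  using det_scaled_identity_pos[OF assms, where 'n = 'n]
  by (simp add: mvnormal_density_scaled_identity[OF assms])

lemma mvnormal_density_le:
  fixes p :: "real^'n"
  assumes "t > 0"
  shows "mvnormal_density 0 (t *\<^sub>R mat 1) p \<le> mvnormal_density 0 (t *\<^sub>R mat 1) (0 :: real^'n)"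
  using det_scaled_identity_pos[OF assms, where 'n = 'n] assms
  by (simp add: mvnormal_density_scaled_identity[OF assms] divide_right_mono)

text \<open>This is how rotations are absorbed below: the Gaussian cannot tell a displacement from
  its rotated copy.\<close>

lemma mvnormal_density_norm_cong:
  fixes p q :: "real^'n"
  assumes "t > 0" "norm p = norm q"
  shows "mvnormal_density 0 (t *\<^sub>R mat 1) p = mvnormal_density 0 (t *\<^sub>R mat 1) q"
  using assms by (simp add: mvnormal_density_scaled_identity)

lemma continuous_on_mvnormal_density:
  assumes "t > 0"
  shows "continuous_on UNIV (mvnormal_density 0 (t *\<^sub>R mat 1) :: real^'n \<Rightarrow> real)"
  using det_scaled_identity_pos[OF assms, where 'n = 'n] assms
  unfolding mvnormal_density_scaled_identity[OF assms, abs_def]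
  by (intro continuous_intros) auto

lemma borel_measurable_mvnormal_density:
  "t > 0 \<Longrightarrow> (mvnormal_density 0 (t *\<^sub>R mat 1) :: real^'n \<Rightarrow> real) \<in> borel_measurable borel"
  by (rule borel_measurable_continuous_onI[OF continuous_on_mvnormal_density])

text \<open>The Gaussian factors over the coordinates, which leaves a product of one-dimensional
  integrals. Finiteness is enough for square integrability, so the value 1 is not computed.\<close>

lemma nn_integral_mvnormal_density_finite:
  assumes t: "t > 0"
  shows "(\<integral>\<^sup>+p. mvnormal_density 0 (t *\<^sub>R mat 1) (p :: real^'n) \<partial>lborel) < \<infinity>"
proof -
  define D where "D = sqrt ((2 * pi) ^ CARD('n) * det (t *\<^sub>R mat 1 :: real^'n^'n))"
  \<comment> \<open>Up to a constant this is the normal density of standard deviation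
    \<open>sqrt t\<close>.\<close>
  have "(\<lambda>x. exp (- x\<^sup>2 / (2 * t))) = (\<lambda>x. sqrt (2 * pi * t) * normal_density 0 (sqrt t) x)"
    using t by (simp add: normal_density_def fun_eq_iff)
  then have "integrable lborel (\<lambda>x. exp (- x\<^sup>2 / (2 * t)))"
    using t integrable_normal_density[of "sqrt t" 0] by simp
  then have fin: "(\<integral>\<^sup>+x. exp (- x\<^sup>2 / (2 * t)) \<partial>lborel) < \<infinity>"
    by (simp add: integrable_iff_bounded)
  have "mvnormal_density 0 (t *\<^sub>R mat 1) p = 1 / D * (\<Prod>b\<in>Basis. exp (- (p \<bullet> b)\<^sup>2 / (2 * t)))"
    for p :: "real^'n"
  proof -
    have "(norm p)\<^sup>2 = (\<Sum>b\<in>Basis. (p \<bullet> b)\<^sup>2)"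
      by (subst power2_norm_eq_inner, subst euclidean_inner) (simp add: power2_eq_square)
    then show ?thesis
      by (simp add: mvnormal_density_scaled_identity[OF t] D_def exp_sum[symmetric]
          sum_negf sum_divide_distrib)
  qed
  moreover have "0 \<le> 1 / D"
    using det_scaled_identity_pos[OF t, where 'n = 'n] by (simp add: D_def)
  ultimately have "(\<integral>\<^sup>+p. mvnormal_density 0 (t *\<^sub>R mat 1) (p :: real^'n) \<partial>lborel) =
      (\<integral>\<^sup>+p. ennreal (1 / D) * (\<Prod>b\<in>Basis. ennreal (exp (- (p \<bullet> b)\<^sup>2 / (2 * t))))
        \<partial>(lborel :: (real^'n) measure))"
    by (simp add: ennreal_mult[symmetric] prod_nonneg prod_ennreal)
  also have "\<dots> = ennreal (1 / D) * (\<Prod>b\<in>(Basis :: (real^'n) set).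
      \<integral>\<^sup>+x. exp (- x\<^sup>2 / (2 * t)) \<partial>lborel)"
    by (subst nn_integral_cmult, measurable)
      (subst nn_integral_lborel_prod, auto)
  also have "\<dots> < \<infinity>"
    using fin by (simp add: ennreal_mult_less_top power_less_top_ennreal)
  finally show ?thesis .
qed

section \<open>The diffusion kernel as an integral over displacements\<close>

lemma se3_act_diff: "se3_act g x - se3_act g y = snd g *v (x - y)"
  by (simp add: se3_act_def matrix_vector_mult_diff_distrib)

lemma se3_mult_assoc: "se3_mult (se3_mult a b) c = se3_mult a (se3_mult b c)"
  by (simp add: se3_mult_def matrix_mul_assoc matrix_vector_mul_assoc matrix_vector_right_distrib
      add.assoc)

lemma se3_one_mult: "se3_mult se3_one g = g" "se3_mult g se3_one = g"
  by (simp_all add: se3_mult_def se3_one_def)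

lemma se3_mult_in_SE3: "a \<in> SE3 \<Longrightarrow> b \<in> SE3 \<Longrightarrow> se3_mult a b \<in> SE3"
  by (auto simp: SE3_def se3_mult_def SO3_mult)

lemma se3_inv_in_SE3: "a \<in> SE3 \<Longrightarrow> se3_inv a \<in> SE3"
  by (auto simp: SE3_def se3_inv_def SO3_transpose)

text \<open>The type \<open>rigid\<close> admits every 3x3 matrix, and \<open>se3_inv\<close>, built
  from the transpose, need not invert such a pair; the membership assumptions here and below come
  from that.\<close>

lemma se3_inv_unique:
  assumes "a \<in> SE3" "se3_mult b a = se3_one"
  shows "b = se3_inv a"
  using assms se3_inv_mult(2)[OF assms(1)] se3_mult_assoc[of b a "se3_inv a"]
  by (simp add: se3_one_mult)

lemma se3_inv_inv: "a \<in> SE3 \<Longrightarrow> se3_inv (se3_inv a) = a"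
  by (metis se3_inv_unique se3_inv_in_SE3 se3_inv_mult(2))

lemma se3_inv_mult_cancel:
  assumes "a \<in> SE3"
  shows "se3_mult (se3_inv a) (se3_mult a b) = b" "se3_mult a (se3_mult (se3_inv a) b) = b"
  using se3_inv_mult[OF assms] by (simp_all add: se3_mult_assoc[symmetric] se3_one_mult)

lemma se3_inv_distrib:
  assumes "a \<in> SE3" "b \<in> SE3"
  shows "se3_inv (se3_mult a b) = se3_mult (se3_inv b) (se3_inv a)"
  by (rule se3_inv_unique[symmetric])
    (use assms in \<open>simp_all add: se3_mult_in_SE3 se3_mult_assoc se3_inv_mult_cancel se3_inv_mult\<close>)

lemma cloud_act_mult: "cloud_act (se3_mult a b) C = cloud_act a (cloud_act b C)"
  by (simp add: cloud_act_def image_image se3_act_mult)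

lemma cloud_act_in_point_clouds: "C \<in> point_clouds \<Longrightarrow> cloud_act g C \<in> point_clouds"
  by (simp add: point_clouds_def cloud_act_def)

section \<open>Conjugation invariance and integration over frames\<close>

lemma trace_SO3_conj:
  assumes "R \<in> SO3"
  shows "trace (R ** (A ** transpose R)) = trace A"
proof -
  have "trace (R ** (A ** transpose R)) = trace (A ** transpose R ** R)"
    by (rule trace_mul_sym)
  then show ?thesis
    by (simp add: matrix_mul_assoc[symmetric] SO3_transpose_mult[OF assms])
qed

text \<open>The rotation part of \<open>e\<close> drops out, since the Gaussian sees only the norm
  of the translation part and \<open>IG_SO3\<close> only the trace of the rotation part.\<close>

lemma brownian_kernel_conj:
  assumes t: "t > 0" and e: "e \<in> SE3"
  shows "brownian_kernel t (se3_mult (se3_mult (se3_inv e) h) e) =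
    mvnormal_density 0 (t *\<^sub>R mat 1) (se3_act h (fst e) - fst e) * IG_SO3 (t / 2) (snd h)"
proof -
  have R: "snd e \<in> SO3"
    using e by (auto simp: SE3_def)
  have "fst (se3_mult (se3_mult (se3_inv e) h) e) =
      transpose (snd e) *v (se3_act h (fst e) - fst e)"
    by (simp add: se3_mult_def se3_inv_def se3_act_def matrix_vector_mul_assoc[symmetric]
        matrix_vector_right_distrib matrix_vector_mult_diff_distrib del: transpose_matrix_vector)
  then have "norm (fst (se3_mult (se3_mult (se3_inv e) h) e)) = norm (se3_act h (fst e) - fst e)"
    using SO3_norm[OF SO3_transpose[OF R]] by simp
  moreover have "trace (transpose (snd e) ** snd h ** snd e) = trace (snd h)"
    using trace_SO3_conj[OF SO3_transpose[OF R]] by (simp add: matrix_mul_assoc)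
  then have "IG_SO3 (t / 2) (snd (se3_mult (se3_mult (se3_inv e) h) e)) = IG_SO3 (t / 2) (snd h)"
    by (simp add: se3_mult_def se3_inv_def IG_SO3_def rotation_angle_def)
  ultimately show ?thesis
    unfolding brownian_kernel_def using mvnormal_density_norm_cong[OF t] by metis
qed

text \<open>By \<open>brownian_kernel_conj\<close> the integrand depends on the frame only through
  its origin, so the integral reduces to the first marginal of the frame law, which is
  \<open>M\<close>; the rotational factor is constant in the frame and comes out.\<close>

lemma diffusion_kernel_frame_selection:
  assumes t: "t > 0" and M: "sets M = sets borel" "prob_space M"
    and eq: "P (cloud_act (se3_inv g0) Os) Oe = M"
  shows "diffusion_kernel (frame_selection P) t g g0 Os Oe =
    (\<integral>p. mvnormal_density 0 (t *\<^sub>R mat 1) (se3_act (se3_mult (se3_inv g0) g) p - p) \<partial>M) *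
    IG_SO3 (t / 2) (snd (se3_mult (se3_inv g0) g))"
proof -
  define h where "h = se3_mult (se3_inv g0) g"
  define N where "N = M \<Otimes>\<^sub>M return SO3_borel (mat 1)"
  define f where "f p = mvnormal_density 0 (t *\<^sub>R mat 1) (se3_act h p - p)" for p
  interpret M: prob_space M by fact
  have one: "mat 1 \<in> space SO3_borel"
    by (simp add: space_SO3_borel SO3_one)
  interpret R: prob_space "return SO3_borel (mat 1)"
    by (rule prob_space_return[OF one])
  have "continuous_on UNIV (\<lambda>p. se3_act h p - p)"
    unfolding se3_act_def matrix_vector_mult_def by (intro continuous_intros)
  then have "f \<in> borel_measurable borel"
    unfolding f_def
    by (intro measurable_compose[OF _ borel_measurable_mvnormal_density[OF t]]
        borel_measurable_continuous_onI)
  then have f: "f \<in> borel_measurable M"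
    using M(1) by (simp cong: measurable_cong_sets)
  have sp: "space N \<subseteq> SE3"
    using sets_eq_imp_space_eq[OF M(1)]
    by (auto simp: N_def space_pair_measure SE3_def space_SO3_borel)
  have "distr N M fst = M"
    unfolding N_def by (rule R.distr_pair_fst)
  then have "integral\<^sup>L M f = integral\<^sup>L (distr N M fst) f"
    by simp
  also have "\<dots> = (\<integral>e. f (fst e) \<partial>N)"
    using f by (intro integral_distr) (simp_all add: N_def)
  finally have "(\<integral>e. f (fst e) * IG_SO3 (t / 2) (snd h) \<partial>N) =
      integral\<^sup>L M f * IG_SO3 (t / 2) (snd h)"
    by simp
  moreover have "diffusion_kernel (frame_selection P) t g g0 Os Oe =
      (\<integral>e. f (fst e) * IG_SO3 (t / 2) (snd h) \<partial>N)"
    unfolding diffusion_kernel_def frame_selection_def eq N_def[symmetric]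
  proof (rule Bochner_Integration.integral_cong[OF refl])
    fix e assume "e \<in> space N"
    then show "brownian_kernel t (se3_mult (se3_mult (se3_mult (se3_inv e) (se3_inv g0)) g) e) =
        f (fst e) * IG_SO3 (t / 2) (snd h)"
      using sp brownian_kernel_conj[OF t, of e h] by (auto simp: f_def h_def se3_mult_assoc)
  qed
  ultimately show ?thesis
    by (simp add: f_def[abs_def] h_def)
qed

section \<open>Square integrability\<close>

lemma sigma_finite_SE3_haar: "sigma_finite_measure SE3_haar"
proof -
  interpret S: prob_space SO3_haar by (rule prob_space_SO3_haar)
  interpret pair_sigma_finite "lborel :: (real^3) measure" SO3_haar ..
  show ?thesis
    unfolding SE3_haar_def by unfold_locales
qed

text \<open>Lets continuity on the ambient space of all pairs give measurability for
  \<open>SE3_haar\<close>, whose second factor carries only the trace of the Borel sets on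
  \<open>SO3\<close>.\<close>

lemma measurable_ident_SE3_haar: "(\<lambda>g. g) \<in> SE3_haar \<rightarrow>\<^sub>M borel"
proof -
  have "(\<lambda>R. R) \<in> SO3_borel \<rightarrow>\<^sub>M borel"
    by (simp add: SO3_borel_def measurable_restrict_space1)
  then have "(\<lambda>R. R) \<in> SO3_haar \<rightarrow>\<^sub>M borel"
    by (simp cong: measurable_cong_sets add: sets_SO3_haar)
  then have "(\<lambda>g. (fst g, snd g)) \<in> SE3_haar \<rightarrow>\<^sub>M borel \<Otimes>\<^sub>M borel"
    unfolding SE3_haar_def
    by (intro measurable_Pair measurable_compose[OF measurable_snd]) measurable
  then show ?thesis
    by (simp add: borel_prod)
qed

lemma nn_integral_lborel_mvnormal_density_translation:
  fixes a :: "real^'n"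
  assumes t: "t > 0"
  shows "(\<integral>\<^sup>+q. mvnormal_density 0 (t *\<^sub>R mat 1) (q + a) \<partial>lborel) =
    (\<integral>\<^sup>+q. mvnormal_density 0 (t *\<^sub>R mat 1) (q :: real^'n) \<partial>lborel)"
proof -
  have "(\<lambda>q. ennreal (mvnormal_density 0 (t *\<^sub>R mat 1) (q :: real^'n))) \<in> borel_measurable borel"
    using borel_measurable_mvnormal_density[OF t] by measurable
  then have "(\<integral>\<^sup>+q. mvnormal_density 0 (t *\<^sub>R mat 1) q \<partial>distr lborel borel ((+) a)) =
      (\<integral>\<^sup>+q. mvnormal_density 0 (t *\<^sub>R mat 1) (a + q) \<partial>lborel)"
    by (intro nn_integral_distr) simp_all
  then show ?thesis
    by (simp add: lborel_distr_plus add.commute)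
qed

lemma square_integrable_displacement_kernel:
  assumes t: "t > 0" and M: "sets M = sets borel" "prob_space M" and g0: "g0 \<in> SE3"
  shows "square_integrable SE3_haar (\<lambda>g.
    (\<integral>p. mvnormal_density 0 (t *\<^sub>R mat 1) (se3_act (se3_mult (se3_inv g0) g) p - p) \<partial>M) *
    IG_SO3 (t / 2) (snd (se3_mult (se3_inv g0) g)))"
proof -
  let ?N = "mvnormal_density 0 (t *\<^sub>R mat 1) :: real^3 \<Rightarrow> real"
  define h where "h g = se3_mult (se3_inv g0) g" for g
  define f where "f g p = ?N (se3_act (h g) p - p)" for g p
  define F where "F g = (\<integral>p. f g p \<partial>M)" for g
  define G where "G g = IG_SO3 (t / 2) (snd (h g))" for g
  interpret M: prob_space M by fact
  interpret S: prob_space SO3_haar by (rule prob_space_SO3_haar)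
  interpret LS: pair_sigma_finite "lborel :: (real^3) measure" SO3_haar ..
  interpret H: sigma_finite_measure SE3_haar by (rule sigma_finite_SE3_haar)
  interpret HM: pair_sigma_finite SE3_haar M ..
  obtain C where C: "\<And>R. \<bar>IG_SO3 (t / 2) R\<bar> \<le> C"
    using bounded_IG_SO3[of "t / 2"] t by auto
  have f_nonneg: "0 \<le> f g p" and f_le: "f g p \<le> ?N 0" for g p
    using mvnormal_density_nonneg[OF t] mvnormal_density_le[OF t] by (simp_all add: f_def)
  have N0: "0 \<le> ?N 0"
    by (rule mvnormal_density_nonneg[OF t])
  have idM: "(\<lambda>p. p) \<in> M \<rightarrow>\<^sub>M borel"
    using M(1) by (simp cong: measurable_cong_sets)
  have "(\<lambda>z. (fst z, snd z)) \<in> SE3_haar \<Otimes>\<^sub>M M \<rightarrow>\<^sub>M borel \<Otimes>\<^sub>M borel"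
    by (intro measurable_Pair measurable_compose[OF measurable_fst measurable_ident_SE3_haar]
        measurable_compose[OF measurable_snd idM])
  then have idHM: "(\<lambda>z. z) \<in> SE3_haar \<Otimes>\<^sub>M M \<rightarrow>\<^sub>M borel"
    by (simp add: borel_prod)
  \<comment> \<open>With \<open>g0\<close> fixed this is polynomial in the entries of the pair,
    which gives the joint measurability that Tonelli's theorem asks for.\<close>
  have "continuous_on UNIV (\<lambda>z. se3_act (h (fst z)) (snd z) - snd z)"
    unfolding se3_act_def h_def se3_mult_def matrix_vector_mult_def matrix_matrix_mult_def fst_conv
      snd_conv
    by (intro continuous_intros)
  then have "(\<lambda>z. f (fst z) (snd z)) \<in> borel_measurable borel"
    unfolding f_def
    by (intro measurable_compose[OF _ borel_measurable_mvnormal_density[OF t]]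
        borel_measurable_continuous_onI)
  from measurable_compose[OF idHM this]
  have f_meas: "case_prod f \<in> borel_measurable (SE3_haar \<Otimes>\<^sub>M M)"
    by (simp add: case_prod_beta')
  have F_meas: "F \<in> borel_measurable SE3_haar"
    unfolding F_def by (rule M.borel_measurable_lebesgue_integral[OF f_meas])
  have "continuous_on UNIV (\<lambda>g. snd (h g))"
    unfolding h_def se3_mult_def matrix_matrix_mult_def snd_conv by (intro continuous_intros)
  then have G_meas: "G \<in> borel_measurable SE3_haar"
    unfolding G_def
    by (intro measurable_compose[OF _ borel_measurable_IG_SO3]
        measurable_compose[OF measurable_ident_SE3_haar] borel_measurable_continuous_onI)
  have fg_meas: "f g \<in> borel_measurable M" if "g \<in> space SE3_haar" for g
    using measurable_compose[OF measurable_Pair1'[OF that] f_meas] by simp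
  have f_int: "integrable M (f g)" if "g \<in> space SE3_haar" for g
    using f_nonneg f_le fg_meas[OF that] by (intro M.integrable_const_bound[where B = "?N 0"]) auto
  have F_nonneg: "0 \<le> F g" for g
    unfolding F_def by (intro Bochner_Integration.integral_nonneg f_nonneg)
  have F_le: "F g \<le> ?N 0" if "g \<in> space SE3_haar" for g
    using integral_mono[OF f_int[OF that], of "\<lambda>_. ?N 0"] f_le by (simp add: F_def M.prob_space)
  have inner: "(\<integral>\<^sup>+g. f g p \<partial>SE3_haar) = (\<integral>\<^sup>+q. ?N q \<partial>lborel)" if p: "p \<in> space M" for p
  proof -
    have m: "(\<lambda>g. ennreal (f g p)) \<in> borel_measurable (lborel \<Otimes>\<^sub>M SO3_haar)"
      using measurable_compose[OF measurable_Pair2'[OF p] f_meas] by (simp add: SE3_haar_def)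
    have R0: "snd g0 \<in> SO3"
      using g0 by (auto simp: SE3_def)
    \<comment> \<open>Applying the isometry \<open>g0\<close> to both ends of the displacement moves
      \<open>q\<close> into a plain shift, so translation invariance of Lebesgue measure suffices in
      place of left invariance of \<open>SE3_haar\<close>.\<close>
    have "f (q, R) p = ?N (q + (R *v p - se3_act g0 p))" for q R
    proof -
      have "se3_act g0 (se3_act (h (q, R)) p) = se3_act (q, R) p"
        using se3_inv_mult_cancel(2)[OF g0] by (simp add: h_def se3_act_mult[symmetric])
      then have "norm (se3_act (h (q, R)) p - p) = norm (se3_act (q, R) p - se3_act g0 p)"
        by (metis SO3_norm[OF R0] se3_act_diff)
      then show ?thesis
        unfolding f_def by (intro mvnormal_density_norm_cong[OF t]) (simp add: se3_act_def algebra_simps)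
    qed
    then have "(\<integral>\<^sup>+q. f (q, R) p \<partial>lborel) = (\<integral>\<^sup>+q. ?N q \<partial>lborel)" for R
      by (simp add: nn_integral_lborel_mvnormal_density_translation[OF t])
    \<comment> \<open>For each \<open>R\<close> the integral over \<open>q\<close> is the same
      constant, and \<open>SO3_haar\<close> has mass 1.\<close>
    then show ?thesis
      unfolding SE3_haar_def by (simp add: LS.nn_integral_snd[OF m, symmetric] S.emeasure_space_1)
  qed
  \<comment> \<open>The Bochner integral \<open>F\<close> agrees with the nonnegative integral
    because \<open>f\<close> is nonnegative and bounded on a probability space.\<close>
  have "(\<integral>\<^sup>+g. F g \<partial>SE3_haar) = (\<integral>\<^sup>+g. \<integral>\<^sup>+p. f g p \<partial>M \<partial>SE3_haar)"
    unfolding F_def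
    by (intro nn_integral_cong nn_integral_eq_integral[symmetric] f_int) (simp_all add: f_nonneg)
  also have "\<dots> = (\<integral>\<^sup>+p. \<integral>\<^sup>+g. f g p \<partial>SE3_haar \<partial>M)"
    using f_meas by (intro HM.Fubini'[symmetric]) (simp add: case_prod_beta')
  also have "\<dots> = (\<integral>\<^sup>+q. ?N q \<partial>lborel)"
    by (simp add: inner M.emeasure_space_1 cong: nn_integral_cong)
  finally have "(\<integral>\<^sup>+g. F g \<partial>SE3_haar) < \<infinity>"
    using nn_integral_mvnormal_density_finite[OF t] by simp
  then have "integrable SE3_haar F"
    using F_meas F_nonneg by (simp add: integrable_iff_bounded)
  then have int: "integrable SE3_haar (\<lambda>g. (?N 0 * C\<^sup>2) * F g)"
    by simp
  have "integrable SE3_haar (\<lambda>g. (F g * G g)\<^sup>2)"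
  proof (rule Bochner_Integration.integrable_bound[OF int])
    show "(\<lambda>g. (F g * G g)\<^sup>2) \<in> borel_measurable SE3_haar"
      using F_meas G_meas by measurable
    show "AE g in SE3_haar. norm ((F g * G g)\<^sup>2) \<le> norm ((?N 0 * C\<^sup>2) * F g)"
    proof (rule AE_I2)
      fix g assume g: "g \<in> space SE3_haar"
      have "(G g)\<^sup>2 \<le> C\<^sup>2"
        using C[of "snd (h g)"] by (intro power2_le_iff_abs_le[THEN iffD2]) (auto simp: G_def)
      \<comment> \<open>Only one of the two factors \<open>F g\<close> is replaced by its bound: a
        constant majorant would not be integrable, as \<open>SE3_haar\<close> has infinite
        mass.\<close>
      moreover have "(F g)\<^sup>2 \<le> ?N 0 * F g"
        unfolding power2_eq_square by (intro mult_right_mono F_le g F_nonneg)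
      ultimately have "(F g)\<^sup>2 * (G g)\<^sup>2 \<le> (?N 0 * F g) * C\<^sup>2"
        using N0 F_nonneg by (intro mult_mono) auto
      then show "norm ((F g * G g)\<^sup>2) \<le> norm ((?N 0 * C\<^sup>2) * F g)"
        using N0 F_nonneg by (simp add: power_mult_distrib abs_mult mult_ac)
    qed
  qed
  then show ?thesis
    using F_meas G_meas
    unfolding square_integrable_def F_def[abs_def] G_def[abs_def] f_def h_def by simp
qed

section \<open>Bi-equivariance\<close>

theorem proposition4:
  fixes t :: real
    and P :: "(real^3) set \<Rightarrow> (real^3) set \<Rightarrow> (real^3) measure"
  assumes "t > 0"
    and "origin_selection P"
    and "equivariant_origin_selection P"
  shows "bi_equivariant (diffusion_kernel (frame_selection P) t)"
proof -
  let ?N = "mvnormal_density 0 (t *\<^sub>R mat 1) :: real^3 \<Rightarrow> real"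
  let ?K = "diffusion_kernel (frame_selection P) t"
  have P: "sets (P O1 O2) = sets borel" "prob_space (P O1 O2)"
    if "O1 \<in> point_clouds" "O2 \<in> point_clouds" for O1 O2
    using assms(2) that by (auto simp: origin_selection_def)
  have K: "?K g g0 Os Oe =
      (\<integral>p. ?N (se3_act (se3_mult (se3_inv g0) g) p - p) \<partial>P (cloud_act (se3_inv g0) Os) Oe) *
      IG_SO3 (t / 2) (snd (se3_mult (se3_inv g0) g))"
    if "Os \<in> point_clouds" "Oe \<in> point_clouds" for g g0 Os Oe
    by (rule diffusion_kernel_frame_selection[OF assms(1) P refl])
      (use that in \<open>simp_all add: cloud_act_in_point_clouds\<close>)
  \<comment> \<open>Both g0\<inverse> g and g0\<inverse> Os are unchanged. This identity and the
    next are proved for every \<open>g\<close>, which is more than almost everywhere.\<close>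
  have left: "?K (se3_mult d g) (se3_mult d g0) (cloud_act d Os) Oe = ?K g g0 Os Oe"
    if "d \<in> SE3" "g0 \<in> SE3" "Os \<in> point_clouds" "Oe \<in> point_clouds" for d g g0 Os Oe
    using that
    by (simp add: K cloud_act_in_point_clouds se3_inv_distrib se3_mult_assoc se3_inv_mult_cancel
        se3_inv_mult se3_one_mult cloud_act_mult[symmetric])
  have right: "?K (se3_mult g (se3_inv d)) (se3_mult g0 (se3_inv d)) Os (cloud_act d Oe) =
      ?K g g0 Os Oe"
    if d: "d \<in> SE3" and g0: "g0 \<in> SE3" and O: "Os \<in> point_clouds" "Oe \<in> point_clouds"
    for d g g0 Os Oe
  proof -
    define h where "h = se3_mult (se3_inv g0) g"
    define h' where "h' = se3_mult d (se3_mult h (se3_inv d))"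
    define M where "M = P (cloud_act (se3_inv g0) Os) Oe"
    have R: "snd d \<in> SO3"
      using d by (auto simp: SE3_def)
    have M: "sets M = sets borel"
      using P O by (simp add: M_def cloud_act_in_point_clouds)
    \<comment> \<open>The first cloud thus becomes \<open>d\<close> applied to g0\<inverse> Os,
      while the second is \<open>d\<close> applied to \<open>Oe\<close>: exactly the situation of
      the equivariance hypothesis.\<close>
    have inv: "se3_inv (se3_mult g0 (se3_inv d)) = se3_mult d (se3_inv g0)"
      using d g0 by (simp add: se3_inv_distrib se3_inv_in_SE3 se3_inv_inv)
    have M': "P (cloud_act (se3_mult d (se3_inv g0)) Os) (cloud_act d Oe) =
        distr M borel (se3_act d)"
      using assms(3) d g0 O by (simp add: equivariant_origin_selection_def M_def)
    have cont: "continuous_on UNIV (se3_act e)" for e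
      unfolding se3_act_def matrix_vector_mult_def by (intro continuous_intros)
    have "se3_act d \<in> borel \<rightarrow>\<^sub>M borel"
      by (intro borel_measurable_continuous_onI cont)
    then have act: "se3_act d \<in> M \<rightarrow>\<^sub>M borel"
      using M by (simp cong: measurable_cong_sets)
    \<comment> \<open>Conjugation by \<open>d\<close> intertwines \<open>h\<close> and
      \<open>h'\<close>, so the displacement of the moved point is the rotated displacement of
      \<open>p\<close>.\<close>
    have "se3_act h' (se3_act d p) = se3_act d (se3_act h p)" for p
      using se3_inv_mult(1)[OF d] unfolding h'_def
      by (simp add: se3_act_mult[symmetric] se3_mult_assoc se3_one_mult)
    then have displ: "?N (se3_act h' (se3_act d p) - se3_act d p) = ?N (se3_act h p - p)" for p
      by (intro mvnormal_density_norm_cong[OF assms(1)]) (simp add: se3_act_diff SO3_norm[OF R])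
    have "trace (snd h') = trace (snd h)"
      by (simp add: h'_def se3_mult_def se3_inv_def trace_SO3_conj[OF R])
    then have IG: "IG_SO3 (t / 2) (snd h') = IG_SO3 (t / 2) (snd h)"
      by (simp add: IG_SO3_def rotation_angle_def)
    have "(\<integral>p. ?N (se3_act h' p - p) \<partial>distr M borel (se3_act d)) =
        (\<integral>p. ?N (se3_act h' (se3_act d p) - se3_act d p) \<partial>M)"
      by (intro integral_distr[OF act]
          measurable_compose[OF _ borel_measurable_mvnormal_density[OF assms(1)]]
          borel_measurable_continuous_onI continuous_on_diff cont continuous_on_id)
    then have "(\<integral>p. ?N (se3_act h' p - p) \<partial>distr M borel (se3_act d)) *
        IG_SO3 (t / 2) (snd h') = (\<integral>p. ?N (se3_act h p - p) \<partial>M) * IG_SO3 (t / 2) (snd h)"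
      by (simp add: displ IG)
    then show ?thesis
      using O by (simp add: K cloud_act_in_point_clouds inv M' h_def h'_def M_def se3_mult_assoc)
  qed
  have "square_integrable SE3_haar (\<lambda>g. ?K g g0 Os Oe)"
    if "g0 \<in> SE3" "Os \<in> point_clouds" "Oe \<in> point_clouds" for g0 Os Oe
    using that unfolding K[OF that(2,3)]
    by (intro square_integrable_displacement_kernel assms(1) P cloud_act_in_point_clouds)
  then show ?thesis
    unfolding bi_equivariant_def using left right by simp
qed

end
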